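(* Let $n,m\in\mathbb{N}$, $S\subseteq\mathbb{Z}^n$, $x(0)\in S$, let $\mathcal{U}\subseteq\mathbb{Z}^n$ be finite, and let $\{U(1),\ldots,U(m)\}$ be a partition of $\mathcal{U}$. Then the restricted partition control problem (RPCP) for $S$, $x(0)$, $\mathcal{U}$ and $\{U(1),\ldots,U(m)\}$ admits a solution if and only if there exists a winning strategy for Player 2 in the safety game (defined in the context) for the same data.
   Context: Notation: $\mathbb{N}$ is the set of strictly positive integers, $\mathbb{N}_0$ the nonnegative integers, $[m]=\{1,\ldots,m\}$. A partition $\{U(1),\ldots,U(m)\}$ of $\mathcal{U}$ is indexed by $[m]$: the sets $U(d)$, $d\in[m]$, are nonempty, pairwise disjoint for distinct indices, and have union $\mathcal{U}$. RPCP. The RPCP admits a solution if there exists a function $\hat{u}:\bigcup_{i=1}^\infty [m]^i\to\mathcal{U}$ such that (i) $\hat{u}(d_1,\ldots,d_k)\in U(d_k)$ for all $k\in\mathbb{N}$ and all $d_1,\ldots,d_k\in[m]$, and (ii) for every $d:\mathbb{N}_0\to[m]$, if $x(t)$ is the solution of $x(t+1)=x(t)+u(t)$, $t\in\mathbb{N}_0$, starting at the given $x(0)$, with $u(t)=\hat{u}(d(0),\ldots,d(t))$, then $x(t)\in S$ for all $t\in\mathbb{N}_0$. Safety game. Let $G=(V,E)$ be the directed graph with $V=\mathbb{Z}^n$ and $E=\{(x,y)\mid y-x\in\mathcal{U}\}$, and let $l:E\to[m]$ be the labeling given by $l(x,y)=d$ if $y-x\in U(d)$. Before time $t=0$ a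 token is placed at $x(0)$. At every time step $t\in\mathbb{N}_0$, Player 1 first chooses an element $d\in[m]$. Then Player 2 chooses an element $x(t+1)\in V$ such that $(x(t),x(t+1))\in E$ and $l(x(t),x(t+1))=d$, if such an element exists, and moves the token to $x(t+1)$; the game then proceeds to the next time step. Player 2 wins if it can always move the token and the token remains within $S$ for all $t\in\mathbb{N}_0$; otherwise Player 1 wins. The game has complete information: Player 2's choice may depend on the whole history of play up to and including Player 1's current choice. A winning strategy for Player 2 is a rule for choosing its moves under which Player 2 wins for every sequence of choices of Player 1. *)

theory Defs
  imports "HOL-Analysis.Finite_Cartesian_Product" "HOL-Library.Disjoint_Sets" "HOL-Library.FuncSet"
begin

definition indexed_partition :: "nat \<Rightarrow> (nat \<Rightarrow> 'a set) \<Rightarrow> 'a set \<Rightarrow> bool" where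
  "indexed_partition m U \<U> \<longleftrightarrow>
     (\<forall>d\<in>{1..m}. U d \<noteq> {}) \<and> disjoint_family_on U {1..m} \<and> (\<Union>d\<in>{1..m}. U d) = \<U>"

(* Nonempty words over [m]; the word d_1 ... d_k is the list [d_1, ..., d_k]. *)
definition words :: "nat \<Rightarrow> nat list set" where
  "words m = {ds. ds \<noteq> [] \<and> set ds \<subseteq> {1..m}}"

definition rpcp_solution ::
  "(int ^ 'n) set \<Rightarrow> int ^ 'n \<Rightarrow> (int ^ 'n) set \<Rightarrow> nat \<Rightarrow> (nat \<Rightarrow> (int ^ 'n) set)
     \<Rightarrow> (nat list \<Rightarrow> int ^ 'n) \<Rightarrow> bool" where
  "rpcp_solution S x0 \<U> m U uhat \<longleftrightarrow>
     uhat \<in> words m \<rightarrow> \<U> \<and>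
     (\<forall>ds\<in>words m. uhat ds \<in> U (last ds)) \<and>
     (\<forall>d\<in>UNIV \<rightarrow> {1..m}. \<forall>x :: nat \<Rightarrow> int ^ 'n.
        x 0 = x0 \<longrightarrow>
        (\<forall>t. x (Suc t) = x t + uhat (map d [0..<Suc t])) \<longrightarrow>
        (\<forall>t. x t \<in> S))"

definition rpcp_admits_solution ::
  "(int ^ 'n) set \<Rightarrow> int ^ 'n \<Rightarrow> (int ^ 'n) set \<Rightarrow> nat \<Rightarrow> (nat \<Rightarrow> (int ^ 'n) set) \<Rightarrow> bool" where
  "rpcp_admits_solution S x0 \<U> m U \<longleftrightarrow> (\<exists>uhat. rpcp_solution S x0 \<U> m U uhat)"

(* The vertex set of the game graph is the whole type int ^ 'n. *)
definition game_edges :: "(int ^ 'n) set \<Rightarrow> ((int ^ 'n) \<times> (int ^ 'n)) set" where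
  "game_edges \<U> = {(x, y). y - x \<in> \<U>}"

(* Meaningful only on edges, and when U is a partition, so that d is unique. *)
definition edge_label :: "nat \<Rightarrow> (nat \<Rightarrow> (int ^ 'n) set) \<Rightarrow> (int ^ 'n) \<times> (int ^ 'n) \<Rightarrow> nat" where
  "edge_label m U e = (THE d. d \<in> {1..m} \<and> snd e - fst e \<in> U d)"

definition legal_moves ::
  "(int ^ 'n) set \<Rightarrow> nat \<Rightarrow> (nat \<Rightarrow> (int ^ 'n) set) \<Rightarrow> int ^ 'n \<Rightarrow> nat \<Rightarrow> (int ^ 'n) set" where
  "legal_moves \<U> m U x d = {y. (x, y) \<in> game_edges \<U> \<and> edge_label m U (x, y) = d}"

(* A history at which Player 2 is to move: the list [(x(0), d(0)), ..., (x(t), d(t))] of the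
   token positions so far, each paired with the choice Player 1 made there. *)
definition game_history ::
  "int ^ 'n \<Rightarrow> (int ^ 'n) set \<Rightarrow> nat \<Rightarrow> (nat \<Rightarrow> (int ^ 'n) set) \<Rightarrow> ((int ^ 'n) \<times> nat) list \<Rightarrow> bool" where
  "game_history x0 \<U> m U h \<longleftrightarrow>
     h \<noteq> [] \<and> fst (hd h) = x0 \<and> (\<forall>i<length h. snd (h ! i) \<in> {1..m}) \<and>
     (\<forall>i. Suc i < length h \<longrightarrow>
        fst (h ! Suc i) \<in> legal_moves \<U> m U (fst (h ! i)) (snd (h ! i)))"

(* At histories without a legal move the value of the strategy is irrelevant. *)
definition player2_strategy ::
  "int ^ 'n \<Rightarrow> (int ^ 'n) set \<Rightarrow> nat \<Rightarrow> (nat \<Rightarrow> (int ^ 'n) set)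
     \<Rightarrow> (((int ^ 'n) \<times> nat) list \<Rightarrow> int ^ 'n) \<Rightarrow> bool" where
  "player2_strategy x0 \<U> m U \<sigma> \<longleftrightarrow>
     (\<forall>h. game_history x0 \<U> m U h \<longrightarrow>
        legal_moves \<U> m U (fst (last h)) (snd (last h)) \<noteq> {} \<longrightarrow>
        \<sigma> h \<in> legal_moves \<U> m U (fst (last h)) (snd (last h)))"

(* The sequence of positions is infinite even if Player 2 gets stuck at some time t; such a
   sequence is lost at time t by player2_wins_play, whatever its entries after t are. *)
definition play_follows ::
  "int ^ 'n \<Rightarrow> (((int ^ 'n) \<times> nat) list \<Rightarrow> int ^ 'n) \<Rightarrow> (nat \<Rightarrow> nat) \<Rightarrow> (nat \<Rightarrow> int ^ 'n) \<Rightarrow> bool" where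
  "play_follows x0 \<sigma> d x \<longleftrightarrow>
     x 0 = x0 \<and> (\<forall>t. x (Suc t) = \<sigma> (map (\<lambda>i. (x i, d i)) [0..<Suc t]))"

definition player2_wins_play ::
  "(int ^ 'n) set \<Rightarrow> (int ^ 'n) set \<Rightarrow> nat \<Rightarrow> (nat \<Rightarrow> (int ^ 'n) set)
     \<Rightarrow> (nat \<Rightarrow> nat) \<Rightarrow> (nat \<Rightarrow> int ^ 'n) \<Rightarrow> bool" where
  "player2_wins_play S \<U> m U d x \<longleftrightarrow>
     (\<forall>t. x (Suc t) \<in> legal_moves \<U> m U (x t) (d t)) \<and> (\<forall>t. x t \<in> S)"

definition player2_winning_strategy ::
  "(int ^ 'n) set \<Rightarrow> int ^ 'n \<Rightarrow> (int ^ 'n) set \<Rightarrow> nat \<Rightarrow> (nat \<Rightarrow> (int ^ 'n) set)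
     \<Rightarrow> (((int ^ 'n) \<times> nat) list \<Rightarrow> int ^ 'n) \<Rightarrow> bool" where
  "player2_winning_strategy S x0 \<U> m U \<sigma> \<longleftrightarrow>
     player2_strategy x0 \<U> m U \<sigma> \<and>
     (\<forall>d\<in>UNIV \<rightarrow> {1..m}. \<forall>x. play_follows x0 \<sigma> d x \<longrightarrow> player2_wins_play S \<U> m U d x)"

end

theory Submission
  imports Defs
begin

text \<open>Along a play the token positions are determined by the choices of Player 1, so a strategy
  reading the full history and a control reading only the choices carry the same information.
  A control \<open>uhat\<close> gives the strategy that adds \<open>uhat\<close> of the word of choices to the current
  position. Conversely, a strategy determines the position reached after each word of choices, and
  the increments of this position form a control.\<close>

text \<open>Disjointness of the classes makes the \<open>THE\<close> in \<open>edge_label\<close>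
  well defined: the label of an edge is the one class containing its increment.\<close>

lemma legal_moves_iff:
  assumes part: "indexed_partition m U \<U>" and d: "d \<in> {1..m}"
  shows "y \<in> legal_moves \<U> m U x d \<longleftrightarrow> y - x \<in> U d"
proof -
  have label: "edge_label m U (x, y) = k" if "k \<in> {1..m}" "y - x \<in> U k" for k
    unfolding edge_label_def
  proof (rule the_equality)
    fix j assume "j \<in> {1..m} \<and> snd (x, y) - fst (x, y) \<in> U j"
    then show "j = k"
      using that part unfolding indexed_partition_def disjoint_family_on_def by fastforce
  qed (use that in simp)
  show ?thesis
  proof
    assume y: "y \<in> legal_moves \<U> m U x d"
    then obtain k where "k \<in> {1..m}" "y - x \<in> U k"
      using part by (auto simp: legal_moves_def game_edges_def indexed_partition_def)
    with y label show "y - x \<in> U d" by (auto simp: legal_moves_def)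
  next
    assume "y - x \<in> U d"
    with d part label show "y \<in> legal_moves \<U> m U x d"
      by (auto simp: legal_moves_def game_edges_def indexed_partition_def)
  qed
qed

lemma map_upt_in_words: "d \<in> UNIV \<rightarrow> {1..m} \<Longrightarrow> map d [0..<Suc t] \<in> words m"
  by (auto simp: words_def Pi_iff)

lemma winning_strategy_of_rpcp_solution:
  assumes part: "indexed_partition m U \<U>" and sol: "rpcp_solution S x0 \<U> m U uhat"
  shows "player2_winning_strategy S x0 \<U> m U (\<lambda>h. fst (last h) + uhat (map snd h))"
    (is "player2_winning_strategy S x0 \<U> m U ?\<sigma>")
  unfolding player2_winning_strategy_def
proof (intro conjI ballI allI impI)
  have uhat: "uhat ds \<in> U (last ds)" if "ds \<in> words m" for ds
    using sol that by (auto simp: rpcp_solution_def)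
  \<comment> \<open>Legality is required even at histories that deviate from the strategy. It holds
    there too, since the increment depends only on the word of choices and lies in the class of its
    last letter.\<close>
  show "player2_strategy x0 \<U> m U ?\<sigma>"
    unfolding player2_strategy_def
  proof (intro allI impI)
    fix h assume "game_history x0 \<U> m U h"
    then have "h \<noteq> []" and choices: "\<forall>e\<in>set h. snd e \<in> {1..m}"
      unfolding game_history_def by (blast, metis in_set_conv_nth)
    moreover from this have "map snd h \<in> words m" by (auto simp: words_def)
    ultimately show "?\<sigma> h \<in> legal_moves \<U> m U (fst (last h)) (snd (last h))"
      using uhat[of "map snd h"] choices by (simp add: legal_moves_iff[OF part] last_map)
  qed
next
  fix d x assume d: "d \<in> UNIV \<rightarrow> {1..m}" and play: "play_follows x0 ?\<sigma> d x"
  have step: "x (Suc t) = x t + uhat (map d [0..<Suc t])" for t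
    using play by (simp add: play_follows_def comp_def)
  have "x t \<in> S" for t
    using sol d play step unfolding rpcp_solution_def play_follows_def by blast
  moreover have "x (Suc t) \<in> legal_moves \<U> m U (x t) (d t)" for t
  proof -
    have "uhat (map d [0..<Suc t]) \<in> U (d t)"
      using sol map_upt_in_words[OF d, of t] by (fastforce simp: rpcp_solution_def)
    then show ?thesis
      using d by (subst legal_moves_iff[OF part]) (auto simp: step)
  qed
  ultimately show "player2_wins_play S \<U> m U d x" by (simp add: player2_wins_play_def)
qed

text \<open>The token position after the choices \<open>ds\<close> when Player 2 follows
  \<open>\<sigma>\<close>. As \<open>\<sigma>\<close> reads the whole history, the recursion runs
  over all proper prefixes of \<open>ds\<close>.\<close>

function position :: "'a \<Rightarrow> (('a \<times> 'b) list \<Rightarrow> 'a) \<Rightarrow> 'b list \<Rightarrow> 'a" where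
  "position x0 \<sigma> ds =
     (if ds = [] then x0
      else \<sigma> (map (\<lambda>i. (position x0 \<sigma> (take i ds), ds ! i)) [0..<length ds]))"
  by pat_completeness auto
termination by (relation "measure (\<lambda>(_, _, ds). length ds)") auto

declare position.simps [simp del]

lemma play_follows_position: "play_follows x0 \<sigma> d (\<lambda>t. position x0 \<sigma> (map d [0..<t]))"
  unfolding play_follows_def
proof (intro conjI allI)
  show "position x0 \<sigma> (map d [0..<0]) = x0" by (simp add: position.simps)
  fix t
  show "position x0 \<sigma> (map d [0..<Suc t]) =
      \<sigma> (map (\<lambda>i. (position x0 \<sigma> (map d [0..<i]), d i)) [0..<Suc t])"
    by (subst position.simps)
      (auto simp: take_map take_upt nth_append simp del: upt_Suc intro!: arg_cong[of _ _ \<sigma>])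
qed

text \<open>Legality of the moves puts the increments in the prescribed classes; safety of the play
  keeps their partial sums in \<open>S\<close>.\<close>

lemma rpcp_solution_of_winning_strategy:
  assumes m: "m \<ge> 1" and part: "indexed_partition m U \<U>"
    and win: "player2_winning_strategy S x0 \<U> m U \<sigma>"
  shows "rpcp_solution S x0 \<U> m U (\<lambda>ds. position x0 \<sigma> ds - position x0 \<sigma> (butlast ds))"
    (is "rpcp_solution S x0 \<U> m U ?uhat")
proof -
  have wins: "player2_wins_play S \<U> m U d (\<lambda>t. position x0 \<sigma> (map d [0..<t]))"
    if "d \<in> UNIV \<rightarrow> {1..m}" for d
    using win that play_follows_position unfolding player2_winning_strategy_def by blast
  have uhat: "?uhat ds \<in> U (last ds)" if ds: "ds \<in> words m" for ds
  proof -
    \<comment> \<open>Winning concerns infinite choice sequences, so the word is padded with 1, an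
      admissible choice because \<open>m \<ge> 1\<close>.\<close>
    define d where "d i = (if i < length ds then ds ! i else 1)" for i
    define t where "t = length ds - 1"
    have len: "length ds = Suc t" using ds by (simp add: words_def t_def)
    have d: "d \<in> UNIV \<rightarrow> {1..m}"
      using ds m nth_mem[of _ ds] unfolding words_def d_def by fastforce
    have full: "map d [0..<Suc t] = ds"
      by (rule nth_equalityI) (auto simp: d_def len simp del: upt_Suc)
    then have "butlast ds = map d [0..<t]" "last ds = d t" by auto
    moreover have "position x0 \<sigma> (map d [0..<Suc t]) - position x0 \<sigma> (map d [0..<t]) \<in> U (d t)"
      using wins[OF d] d
      by (subst legal_moves_iff[OF part, symmetric]) (auto simp: player2_wins_play_def)
    ultimately show ?thesis using full by simp
  qed
  have "?uhat ds \<in> \<U>" if ds: "ds \<in> words m" for ds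
  proof -
    have "last ds \<in> {1..m}" using ds last_in_set[of ds] unfolding words_def by blast
    with uhat[OF ds] part show ?thesis by (auto simp: indexed_partition_def)
  qed
  moreover have "x t \<in> S"
    if d: "d \<in> UNIV \<rightarrow> {1..m}" and x0: "x 0 = x0"
      and step: "\<And>t. x (Suc t) = x t + ?uhat (map d [0..<Suc t])" for d x t
  proof -
    \<comment> \<open>The increments telescope: \<open>butlast\<close> turns the word of the first
      \<open>t + 1\<close> choices into that of the first \<open>t\<close>.\<close>
    have "x t = position x0 \<sigma> (map d [0..<t])"
      by (induction t) (simp_all add: x0 step position.simps[of _ _ "[]"] butlast_append)
    then show ?thesis using wins[OF d] by (simp add: player2_wins_play_def)
  qed
  ultimately show ?thesis using uhat by (auto simp: rpcp_solution_def)
qed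

theorem proposition1:
  fixes S \<U> :: "(int ^ 'n) set" and x0 :: "int ^ 'n"
    and m :: nat and U :: "nat \<Rightarrow> (int ^ 'n) set"
  assumes "m \<ge> 1"
    and "x0 \<in> S"
    and "finite \<U>"
    and "indexed_partition m U \<U>"
  shows "rpcp_admits_solution S x0 \<U> m U \<longleftrightarrow>
         (\<exists>\<sigma>. player2_winning_strategy S x0 \<U> m U \<sigma>)"
  using winning_strategy_of_rpcp_solution[OF assms(4)]
    rpcp_solution_of_winning_strategy[OF assms(1,4)]
  unfolding rpcp_admits_solution_def by blast

end
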